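(* Let $k\ge1$, let $a_i,b_i,c_i$ ($i\in\mathbb{Z}$) be real and $k$-periodic in $i$ with $b_ic_i>0$ for all $i$ and $\prod_{i=1}^k\frac{b_i}{c_i}>1$, and let $f$ be the associated symbol. Let $m\in\mathbb{Z}$, let $\mathbf{L}(f)$ be the associated tridiagonal $k$-Laurent operator with a defect at site $m$, and let $\mathbf{L}_N(f)\in\mathbb{R}^{N\times N}$ be its truncation centred at the defect site. Let $\lambda\in\sigma_{\mathrm{wind}}^{\mathsf c}\setminus\sigma_{\mathrm{det}}$, where $\sigma_{\mathrm{wind}}^{\mathsf c}=\mathbb{R}\setminus\sigma_{\mathrm{wind}}$, let $\mathbf{u}\in\ell^2(\mathbb{Z},\mathbb{C})$ be an eigenvector of the defected operator $\mathbf{L}(f)$ with eigenvalue $\lambda$, and (for $N$ large) let $\mathbf{v}_{0,N}\in\mathbb{C}^N$ be its truncation centred at the defect site, normalised so that $\|\mathbf{v}_{0,N}\|_2=1$. Then $\mathbf{v}_{0,N}$ is an $\varepsilon_N$-pseudoeigenvector of $\mathbf{L}_N(f)$ (for $\lambda$), with $$\varepsilon_N=\mathcal{O}\bigl(e^{-B\lfloor N/2k\rfloor}\bigr)\quad\text{as }N\to\infty,$$ where $B=\tilde\beta(\lambda)-r>0$, $r=\frac12\log\bigl(\prod_{i=1}^k\frac{b_i}{c_i}\bigr)$, and $\tilde\beta(\lambda)$ is the nonnegative real part of $\operatorname{arccosh}\bigl(-\frac{g(\lambda)}{2Ae^{r}}\bigr)$, i.e. $\tilde\beta(\lambda)=\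operatorname{arccosh}\bigl|\frac{g(\lambda)}{2Ae^{r}}\bigr|$.
   Context: The (pristine) tridiagonal $k$-Laurent operator is the doubly infinite tridiagonal matrix indexed by $\mathbb{Z}$, acting on $\ell^2(\mathbb{Z},\mathbb{C})$, with entries $a_i$ at $(i,i)$, $b_i$ at $(i,i+1)$ and $c_i$ at $(i+1,i)$. The operator with a defect at site $m$ is obtained from it by replacing the (at most three) tridiagonal entries of row $m$ by other real numbers; all other rows are unchanged. The truncation of size $N$ centred at the defect site (of a matrix or of a vector) keeps the $N$ consecutive indices $m-\lfloor N/2\rfloor+1,\dots,m-\lfloor N/2\rfloor+N$, so that the defect is at position $\lfloor N/2\rfloor$ of the truncated system. Let $\mathbf{A}_0$ be the $k\times k$ tridiagonal matrix with diagonal $a_1,\dots,a_k$, superdiagonal $b_1,\dots,b_{k-1}$, subdiagonal $c_1,\dots,c_{k-1}$; let $\mathbf{A}_{-1}$ be the $k\times k$ matrix with single nonzero entry $b_k$ in position $(k,1)$, and $\mathbf{A}_1$ the one with single nonzero entry $c_k$ in position $(1,k)$ (for $k=1$ these are the scalars $a_1,b_1,c_1$). The symbol is $f(z)=\mathbf{A}_{-1}z^{-1}+\mathbf{A}_0+\mathbf{A}_1z$ for $z\in\mathbb{C}\setminus\{0\}$. Notation: $A=(-1)^{k+1}\prod_{i=1}^kc_i$, and $g(\lambda)=\det(\mathbf{A}_0-\lambda\,\mathrm{Id})-b_kc_k\,p(\lambda)$, where $p=0$ if $k=1$, $p=1$ if $k=2$, and for $k\ge3$ $p(\lambda)$ is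 the determinant of the submatrix of $\mathbf{A}_0-\lambda\,\mathrm{Id}$ formed by rows and columns $2,\dots,k-1$. The winding region $\sigma_{\mathrm{wind}}$ is the set of $\lambda\in\mathbb{R}$ such that the closed curve $\theta\mapsto\det(f(e^{-\mathrm{i}\theta})-\lambda\,\mathrm{Id})$, $\theta$ from $0$ to $2\pi$, avoids $0$ and has winding number $>0$ around $0$. Also $\sigma_{\mathrm{det}}=\{\lambda\in\mathbb{R}:\det(f(z)-\lambda\,\mathrm{Id})=0\text{ for some }|z|=1\}$. A unit vector $\mathbf{u}\in\mathbb{C}^N$ is an $\varepsilon$-pseudoeigenvector of $\mathbf{A}\in\mathbb{C}^{N\times N}$ (for $\lambda$) if $\|(\mathbf{A}-\lambda\,\mathrm{Id})\mathbf{u}\|_2<\varepsilon$. *)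

theory Defs
  imports
    "HOL-Complex_Analysis.Winding_Numbers"
    "HOL-Library.Landau_Symbols"
    "Jordan_Normal_Form.Determinant"
begin

(* Vectors and matrices are those of Jordan_Normal_Form, which are indexed from 0; position (i, j)
   of a matrix in the 1-based mathematical convention is position (i - 1, j - 1) here. *)
hide_const (open) Finite_Cartesian_Product.vec Finite_Cartesian_Product.mat Determinants.det
unbundle no vec_syntax


subsection \<open>The operator and its defect\<close>

definition k_periodic :: "nat \<Rightarrow> (int \<Rightarrow> real) \<Rightarrow> bool" where
  "k_periodic k x \<longleftrightarrow> (\<forall>i. x (i + int k) = x i)"

definition laurent_entry ::
  "(int \<Rightarrow> real) \<Rightarrow> (int \<Rightarrow> real) \<Rightarrow> (int \<Rightarrow> real) \<Rightarrow> int \<Rightarrow> int \<Rightarrow> real" where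
  "laurent_entry a b c i j =
     (if j = i then a i else if j = i + 1 then b i else if i = j + 1 then c j else 0)"

definition defect_entry ::
  "(int \<Rightarrow> real) \<Rightarrow> (int \<Rightarrow> real) \<Rightarrow> (int \<Rightarrow> real) \<Rightarrow>
     int \<Rightarrow> real \<Rightarrow> real \<Rightarrow> real \<Rightarrow> int \<Rightarrow> int \<Rightarrow> real" where
  "defect_entry a b c m d_left d_diag d_right i j =
     (if i = m
      then (if j = m - 1 then d_left else if j = m then d_diag else if j = m + 1 then d_right else 0)
      else laurent_entry a b c i j)"

definition ell2_Z :: "(int \<Rightarrow> complex) set" where
  "ell2_Z = {u. (\<lambda>i. (cmod (u i))\<^sup>2) summable_on UNIV}"

(* For a matrix with finitely many nonzero entries in each row, the infsum is a finite sum. *)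
definition bi_apply :: "(int \<Rightarrow> int \<Rightarrow> real) \<Rightarrow> (int \<Rightarrow> complex) \<Rightarrow> int \<Rightarrow> complex" where
  "bi_apply M u i = (\<Sum>\<^sub>\<infinity>j. of_real (M i j) * u j)"

definition ell2_eigenvector :: "(int \<Rightarrow> int \<Rightarrow> real) \<Rightarrow> complex \<Rightarrow> (int \<Rightarrow> complex) \<Rightarrow> bool" where
  "ell2_eigenvector M \<mu> u \<longleftrightarrow>
     u \<in> ell2_Z \<and> u \<noteq> (\<lambda>_. 0) \<and> bi_apply M u = (\<lambda>i. \<mu> * u i)"


subsection \<open>Truncation centred at the defect site\<close>

(* The kept indices are m - N div 2 + 1, ..., m - N div 2 + N. *)
definition trunc_index :: "int \<Rightarrow> nat \<Rightarrow> nat \<Rightarrow> int" where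
  "trunc_index m N i = m - int (N div 2) + 1 + int i"

definition trunc_mat :: "int \<Rightarrow> nat \<Rightarrow> (int \<Rightarrow> int \<Rightarrow> real) \<Rightarrow> real mat" where
  "trunc_mat m N M = mat N N (\<lambda>(i, j). M (trunc_index m N i) (trunc_index m N j))"

definition trunc_vec :: "int \<Rightarrow> nat \<Rightarrow> (int \<Rightarrow> complex) \<Rightarrow> complex vec" where
  "trunc_vec m N u = vec N (\<lambda>i. u (trunc_index m N i))"

definition norm2 :: "complex vec \<Rightarrow> real" where
  "norm2 v = L2_set (\<lambda>i. cmod (v $ i)) {..<dim_vec v}"

definition normalised :: "complex vec \<Rightarrow> complex vec" where
  "normalised v = complex_of_real (1 / norm2 v) \<cdot>\<^sub>v v"

definition pseudoeigenvector ::
  "real \<Rightarrow> complex mat \<Rightarrow> complex \<Rightarrow> complex vec \<Rightarrow> bool" where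
  "pseudoeigenvector \<epsilon> M \<mu> v \<longleftrightarrow>
     M \<in> carrier_mat (dim_vec v) (dim_vec v) \<and> norm2 v = 1 \<and>
     norm2 ((M - \<mu> \<cdot>\<^sub>m 1\<^sub>m (dim_vec v)) *\<^sub>v v) < \<epsilon>"


subsection \<open>The symbol\<close>

definition A_zero ::
  "nat \<Rightarrow> (int \<Rightarrow> real) \<Rightarrow> (int \<Rightarrow> real) \<Rightarrow> (int \<Rightarrow> real) \<Rightarrow> real mat" where
  "A_zero k a b c = mat k k (\<lambda>(i, j).
     if j = i then a (int i + 1)
     else if j = i + 1 then b (int i + 1)
     else if i = j + 1 then c (int j + 1)
     else 0)"

definition A_minus :: "nat \<Rightarrow> (int \<Rightarrow> real) \<Rightarrow> real mat" where
  "A_minus k b = mat k k (\<lambda>(i, j). if i = k - 1 \<and> j = 0 then b (int k) else 0)"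

definition A_plus :: "nat \<Rightarrow> (int \<Rightarrow> real) \<Rightarrow> real mat" where
  "A_plus k c = mat k k (\<lambda>(i, j). if i = 0 \<and> j = k - 1 then c (int k) else 0)"

definition symbol ::
  "nat \<Rightarrow> (int \<Rightarrow> real) \<Rightarrow> (int \<Rightarrow> real) \<Rightarrow> (int \<Rightarrow> real) \<Rightarrow> complex \<Rightarrow> complex mat" where
  "symbol k a b c z =
     inverse z \<cdot>\<^sub>m map_mat complex_of_real (A_minus k b)
     + map_mat complex_of_real (A_zero k a b c)
     + z \<cdot>\<^sub>m map_mat complex_of_real (A_plus k c)"

definition symbol_det ::
  "nat \<Rightarrow> (int \<Rightarrow> real) \<Rightarrow> (int \<Rightarrow> real) \<Rightarrow> (int \<Rightarrow> real) \<Rightarrow> real \<Rightarrow> complex \<Rightarrow> complex" where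
  "symbol_det k a b c lam z = det (symbol k a b c z - complex_of_real lam \<cdot>\<^sub>m 1\<^sub>m k)"

definition sigma_det ::
  "nat \<Rightarrow> (int \<Rightarrow> real) \<Rightarrow> (int \<Rightarrow> real) \<Rightarrow> (int \<Rightarrow> real) \<Rightarrow> real set" where
  "sigma_det k a b c = {lam. \<exists>z. cmod z = 1 \<and> symbol_det k a b c lam z = 0}"

(* Paths are parametrised over [0, 1], so the angle is 2 * pi * t. *)
definition symbol_curve ::
  "nat \<Rightarrow> (int \<Rightarrow> real) \<Rightarrow> (int \<Rightarrow> real) \<Rightarrow> (int \<Rightarrow> real) \<Rightarrow> real \<Rightarrow> real \<Rightarrow> complex" where
  "symbol_curve k a b c lam t = symbol_det k a b c lam (exp (- \<i> * complex_of_real (2 * pi * t)))"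

(* The library's winding number is complex-valued; for a closed path avoiding the point it is an
   integer, so its positivity is that of its real part. *)
definition sigma_wind ::
  "nat \<Rightarrow> (int \<Rightarrow> real) \<Rightarrow> (int \<Rightarrow> real) \<Rightarrow> (int \<Rightarrow> real) \<Rightarrow> real set" where
  "sigma_wind k a b c =
     {lam. 0 \<notin> path_image (symbol_curve k a b c lam) \<and>
          Re (winding_number (symbol_curve k a b c lam) 0) > 0}"


subsection \<open>The decay rate\<close>

definition A_coeff :: "nat \<Rightarrow> (int \<Rightarrow> real) \<Rightarrow> real" where
  "A_coeff k c = (- 1) ^ (k + 1) * (\<Prod>i=1..k. c (int i))"

(* For k >= 3 the matrix below consists of rows and columns 2, ..., k - 1 (counted from 1). *)
definition p_minor ::
  "nat \<Rightarrow> (int \<Rightarrow> real) \<Rightarrow> (int \<Rightarrow> real) \<Rightarrow> (int \<Rightarrow> real) \<Rightarrow> real \<Rightarrow> real" where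
  "p_minor k a b c lam =
     (if k = 1 then 0
      else if k = 2 then 1
      else det (mat (k - 2) (k - 2)
                  (\<lambda>(i, j). (A_zero k a b c - lam \<cdot>\<^sub>m 1\<^sub>m k) $$ (i + 1, j + 1))))"

definition g_fun ::
  "nat \<Rightarrow> (int \<Rightarrow> real) \<Rightarrow> (int \<Rightarrow> real) \<Rightarrow> (int \<Rightarrow> real) \<Rightarrow> real \<Rightarrow> real" where
  "g_fun k a b c lam =
     det (A_zero k a b c - lam \<cdot>\<^sub>m 1\<^sub>m k) - b (int k) * c (int k) * p_minor k a b c lam"

definition r_rate :: "nat \<Rightarrow> (int \<Rightarrow> real) \<Rightarrow> (int \<Rightarrow> real) \<Rightarrow> real" where
  "r_rate k b c = ln (\<Prod>i=1..k. b (int i) / c (int i)) / 2"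

(* If w is one value of the multivalued complex arccosh at a point, its values there are
   w + 2 * pi * i * n and - w + 2 * pi * i * n for integers n; hence the absolute value, which selects
   the nonnegative real part. *)
definition beta_tilde ::
  "nat \<Rightarrow> (int \<Rightarrow> real) \<Rightarrow> (int \<Rightarrow> real) \<Rightarrow> (int \<Rightarrow> real) \<Rightarrow> real \<Rightarrow> real" where
  "beta_tilde k a b c lam =
     \<bar>Re (arcosh (complex_of_real
        (- (g_fun k a b c lam / (2 * A_coeff k c * exp (r_rate k b c))))))\<bar>"

definition B_rate ::
  "nat \<Rightarrow> (int \<Rightarrow> real) \<Rightarrow> (int \<Rightarrow> real) \<Rightarrow> (int \<Rightarrow> real) \<Rightarrow> real \<Rightarrow> real" where
  "B_rate k a b c lam = beta_tilde k a b c lam - r_rate k b c"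

end

(*
  Let A' = (-1)^(k+1) prod b_i = A e^(2r). Expanding the corner entries gives
  det (f(z) - lam) = g + A z + A'/z, which traces an ellipse with centre g when |z| = 1. The
  hypotheses on lam say that 0 lies outside it, i.e. |g| > |A + A'|; then the determinant has two
  real roots z and z' with |z| = e^(-B) < 1 and |z'| = e^(r + beta) > 1. Kernel vectors of f(z) - lam
  and f(z') - lam yield two independent solutions of the three-term recurrence with
  phi (i + k) = phi i / z and psi (i + k) = psi i / z'. On either side of the defect a bounded
  solution is a multiple of the decaying one, so an eigenvector decays at least like e^(-B) per
  period; the truncation only leaves a residual in the first and the last row.
*)
theory Submission
  imports Defs
begin

subsection \<open>The determinant of the symbol\<close>

text \<open>The cofactors along row \<open>p\<close> do not see the entries of that row, so exactly
  one term of the Laplace expansion along it changes.\<close>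

lemma det_add_entry:
  fixes A :: "'a :: comm_ring_1 mat"
  assumes A: "A \<in> carrier_mat n n" and p: "p < n" and q: "q < n"
  shows "det (mat n n (\<lambda>(i, j). A $$ (i, j) + (if i = p \<and> j = q then x else 0)))
           = det A + x * cofactor A p q"
proof -
  define B where "B = mat n n (\<lambda>(i, j). A $$ (i, j) + (if i = p \<and> j = q then x else 0))"
  have B: "B \<in> carrier_mat n n" by (simp add: B_def)
  have Bp: "B $$ (p, j) = A $$ (p, j) + (if j = q then x else 0)" if "j < n" for j
    using that p by (simp add: B_def)
  have "mat_delete B p j = mat_delete A p j" if "j < n" for j
    using A p that by (intro eq_matI) (auto simp: mat_delete_def B_def)
  hence cof: "cofactor B p j = cofactor A p j" if "j < n" for j
    using that by (simp add: cofactor_def)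
  have "det B = (\<Sum>j<n. A $$ (p, j) * cofactor A p j + (if j = q then x * cofactor A p j else 0))"
    unfolding laplace_expansion_row[OF B p]
    by (rule sum.cong) (auto simp: cof Bp algebra_simps)
  also have "\<dots> = det A + x * cofactor A p q"
    using q by (simp add: sum.distrib laplace_expansion_row[OF A p])
  finally show ?thesis by (simp add: B_def)
qed

definition tridiag :: "(nat \<Rightarrow> 'a) \<Rightarrow> (nat \<Rightarrow> 'a) \<Rightarrow> (nat \<Rightarrow> 'a) \<Rightarrow> nat \<Rightarrow> nat \<Rightarrow> 'a :: zero" where
  "tridiag d e f i j =
     (if j = i then d i else if j = i + 1 then e i else if i = j + 1 then f j else 0)"

lemma prod_list_diag_mat: "prod_list (diag_mat A) = (\<Prod>i<dim_row A. A $$ (i, i))"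
  for A :: "'a :: comm_ring_1 mat"
  by (simp add: diag_mat_def prod.list_conv_set_nth atLeast0LessThan)

text \<open>The corners are inserted one at a time with \<open>det_add_entry\<close>. The minor
  belonging to the upper right corner is upper triangular with diagonal \<open>f\<close>. The minor
  belonging to the lower left corner is lower triangular with diagonal \<open>e\<close>, except that
  it still carries \<open>y\<close> in its own upper right corner; this produces the cross term.
  Corners are added to the entries, not substituted for them, so \<open>n = 0\<close> is covered:
  there they fall on the off-diagonals, and the inner determinant is empty, hence 1.\<close>

lemma det_tridiag_corners:
  fixes d e f :: "nat \<Rightarrow> 'a :: comm_ring_1"
  shows "det (mat (n + 2) (n + 2) (\<lambda>(i, j). tridiag d e f i j
             + (if i = n + 1 \<and> j = 0 then x else 0) + (if i = 0 \<and> j = n + 1 then y else 0)))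
         = det (mat (n + 2) (n + 2) (\<lambda>(i, j). tridiag d e f i j))
           + (- 1) ^ (n + 1) * (x * (\<Prod>i<n + 1. e i) + y * (\<Prod>i<n + 1. f i))
           - x * y * det (mat n n (\<lambda>(i, j). tridiag d e f (i + 1) (j + 1)))"
proof -
  let ?k = "n + 2"
  define T where "T = mat ?k ?k (\<lambda>(i, j). tridiag d e f i j)"
  define Ty where "Ty = mat ?k ?k (\<lambda>(i, j). T $$ (i, j) + (if i = 0 \<and> j = n + 1 then y else 0))"
  define S where "S = mat (n + 1) (n + 1) (\<lambda>(i, j). tridiag d e f i (j + 1))"
  define In where "In = mat n n (\<lambda>(i, j). tridiag d e f (i + 1) (j + 1))"
  have T: "T \<in> carrier_mat ?k ?k" and Ty: "Ty \<in> carrier_mat ?k ?k"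
    and S: "S \<in> carrier_mat (n + 1) (n + 1)" by (simp_all add: T_def Ty_def S_def)
  have "det (mat_delete T 0 (n + 1)) = prod_list (diag_mat (mat_delete T 0 (n + 1)))"
    using T by (intro det_upper_triangular[of _ "n + 1"])
      (auto simp: mat_delete_def upper_triangular_def T_def tridiag_def)
  also have "\<dots> = (\<Prod>i<n + 1. f i)"
    using T by (auto simp: prod_list_diag_mat mat_delete_def T_def tridiag_def intro!: prod.cong)
  finally have cofT: "cofactor T 0 (n + 1) = (- 1) ^ (n + 1) * (\<Prod>i<n + 1. f i)"
    by (simp add: cofactor_def)
  have detTy: "det Ty = det T + y * ((- 1) ^ (n + 1) * (\<Prod>i<n + 1. f i))"
    unfolding Ty_def cofT[symmetric] by (rule det_add_entry[OF T]) auto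
  have "det S = prod_list (diag_mat S)"
    by (rule det_lower_triangular[OF _ S]) (auto simp: S_def tridiag_def)
  also have "\<dots> = (\<Prod>i<n + 1. e i)"
    by (auto simp: prod_list_diag_mat S_def tridiag_def intro!: prod.cong)
  finally have detS: "det S = (\<Prod>i<n + 1. e i)" .
  have "mat_delete S 0 n = In"
    by (rule eq_matI) (auto simp: mat_delete_def S_def In_def)
  hence cofS: "cofactor S 0 n = (- 1) ^ n * det In"
    by (simp add: cofactor_def)
  have del: "mat_delete Ty (n + 1) 0
      = mat (n + 1) (n + 1) (\<lambda>(i, j). S $$ (i, j) + (if i = 0 \<and> j = n then y else 0))"
    by (rule eq_matI) (auto simp: mat_delete_def S_def Ty_def T_def)
  have "det (mat_delete Ty (n + 1) 0) = (\<Prod>i<n + 1. e i) + y * ((- 1) ^ n * det In)"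
    unfolding del detS[symmetric] cofS[symmetric] by (rule det_add_entry[OF S]) auto
  hence cofTy: "cofactor Ty (n + 1) 0
      = (- 1) ^ (n + 1) * ((\<Prod>i<n + 1. e i) + y * ((- 1) ^ n * det In))"
    by (simp add: cofactor_def)
  \<comment> \<open>The cross term collects the signs of two cofactors, of parities
    \<open>n + 1\<close> and \<open>n\<close>; their product is -1.\<close>
  have sq: "(- 1) ^ n * (- 1) ^ n = (1 :: 'a)"
    by (simp flip: power_add mult_2)
  have "det (mat ?k ?k (\<lambda>(i, j). Ty $$ (i, j) + (if i = n + 1 \<and> j = 0 then x else 0)))
      = det Ty + x * cofactor Ty (n + 1) 0"
    by (rule det_add_entry[OF Ty]) auto
  also have "\<dots> = det T + (- 1) ^ (n + 1) * (x * (\<Prod>i<n + 1. e i) + y * (\<Prod>i<n + 1. f i))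
           - x * y * det In * ((- 1) ^ n * (- 1) ^ n)"
    unfolding detTy cofTy by (simp add: algebra_simps)
  also have "mat ?k ?k (\<lambda>(i, j). Ty $$ (i, j) + (if i = n + 1 \<and> j = 0 then x else 0))
      = mat ?k ?k (\<lambda>(i, j). tridiag d e f i j
             + (if i = n + 1 \<and> j = 0 then x else 0) + (if i = 0 \<and> j = n + 1 then y else 0))"
    by (rule eq_matI) (auto simp: Ty_def T_def algebra_simps)
  finally show ?thesis by (simp add: sq T_def In_def)
qed

text \<open>\<open>A_coeff k b\<close> is the signed product A' of the superdiagonal. The variable
  cancels in the product of the two corners, so the determinant is affine in \<open>z\<close> and
  \<open>inverse z\<close>, and its constant term is the g of the theorem.\<close>

lemma symbol_det_eq:
  fixes a b c :: "int \<Rightarrow> real"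
  assumes k: "k \<ge> 1" and z: "z \<noteq> 0"
  shows "symbol_det k a b c lam z = complex_of_real (g_fun k a b c lam)
           + complex_of_real (A_coeff k c) * z
           + complex_of_real (A_coeff k b) * inverse z"
proof (cases "k = 1")
  \<comment> \<open>For \<open>k = 1\<close> all three coefficients sit in the single entry, and
    there are no two distinct corners to expand.\<close>
  case True
  have "det (mat (Suc 0) (Suc 0) h) = h (0, 0)" for h :: "nat \<times> nat \<Rightarrow> complex"
    by (subst det_lower_triangular[of "Suc 0"]) (auto simp: prod_list_diag_mat)
  moreover have "det (mat (Suc 0) (Suc 0) h) = h (0, 0)" for h :: "nat \<times> nat \<Rightarrow> real"
    by (subst det_lower_triangular[of "Suc 0"]) (auto simp: prod_list_diag_mat)
  moreover have "symbol k a b c z - complex_of_real lam \<cdot>\<^sub>m 1\<^sub>m k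
     = mat (Suc 0) (Suc 0) (\<lambda>_. a 1 - lam + c 1 * z + b 1 * inverse z)"
    using True by (intro eq_matI) (auto simp: symbol_def A_zero_def A_minus_def A_plus_def)
  moreover have "A_zero k a b c - lam \<cdot>\<^sub>m 1\<^sub>m k = mat (Suc 0) (Suc 0) (\<lambda>_. a 1 - lam)"
    using True by (intro eq_matI) (auto simp: A_zero_def)
  ultimately show ?thesis
    using True by (simp add: symbol_det_def g_fun_def p_minor_def A_coeff_def)
next
  case False
  then obtain n where n: "k = n + 2" using k
    by (metis One_nat_def Suc_eq_plus1 add_2_eq_Suc' le_antisym not_less_eq_eq ordered_cancel_comm_monoid_diff_class.add_diff_inverse add.commute)
  define d e f where "d = (\<lambda>i. complex_of_real (a (int i + 1) - lam))"
    and "e = (\<lambda>i. complex_of_real (b (int i + 1)))" and "f = (\<lambda>i. complex_of_real (c (int i + 1)))"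
  let ?x = "inverse z * complex_of_real (b (int k))" and ?y = "z * complex_of_real (c (int k))"
  have "symbol k a b c z - complex_of_real lam \<cdot>\<^sub>m 1\<^sub>m k
     = mat (n + 2) (n + 2) (\<lambda>(i, j). tridiag d e f i j
             + (if i = n + 1 \<and> j = 0 then ?x else 0) + (if i = 0 \<and> j = n + 1 then ?y else 0))"
    using n by (intro eq_matI)
      (auto simp: symbol_def A_zero_def A_minus_def A_plus_def tridiag_def d_def e_def f_def)
  hence "symbol_det k a b c lam z = det (mat (n + 2) (n + 2) (\<lambda>(i, j). tridiag d e f i j))
           + (- 1) ^ (n + 1) * (?x * (\<Prod>i<n + 1. e i) + ?y * (\<Prod>i<n + 1. f i))
           - ?x * ?y * det (mat n n (\<lambda>(i, j). tridiag d e f (i + 1) (j + 1)))"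
    unfolding symbol_det_def by (simp only: det_tridiag_corners)
  also have "mat (n + 2) (n + 2) (\<lambda>(i, j). tridiag d e f i j)
      = map_mat complex_of_real (A_zero k a b c - lam \<cdot>\<^sub>m 1\<^sub>m k)"
    using n by (intro eq_matI) (auto simp: A_zero_def tridiag_def d_def e_def f_def)
  also have "mat n n (\<lambda>(i, j). tridiag d e f (i + 1) (j + 1))
      = map_mat complex_of_real (mat n n (\<lambda>(i, j). (A_zero k a b c - lam \<cdot>\<^sub>m 1\<^sub>m k) $$ (i + 1, j + 1)))"
    using n by (intro eq_matI) (auto simp: A_zero_def tridiag_def d_def e_def f_def)
  also have "det (map_mat complex_of_real (mat n n (\<lambda>(i, j). (A_zero k a b c - lam \<cdot>\<^sub>m 1\<^sub>m k) $$ (i + 1, j + 1))))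
      = complex_of_real (p_minor k a b c lam)"
    unfolding of_real_hom.hom_det using n by (simp add: p_minor_def)
  finally have 1: "symbol_det k a b c lam z = complex_of_real (det (A_zero k a b c - lam \<cdot>\<^sub>m 1\<^sub>m k))
     + (- 1) ^ (n + 1) * (?x * (\<Prod>i<n + 1. e i) + ?y * (\<Prod>i<n + 1. f i))
     - ?x * ?y * complex_of_real (p_minor k a b c lam)"
    unfolding of_real_hom.hom_det .
  \<comment> \<open>The factor with index \<open>k\<close> is the corner entry; splitting it off
    turns corner times inner product into the full products of \<open>A_coeff\<close>.\<close>
  have shift: "(\<Prod>i=1..k. h (int i)) = (\<Prod>i<n + 1. h (int i + 1)) * h (int k)" for h :: "int \<Rightarrow> real"
  proof -
    have "(\<Prod>i=1..k. h (int i)) = (\<Prod>i<n + 2. h (int i + 1))"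
      unfolding n by (rule prod.reindex_bij_witness[of _ Suc "\<lambda>i. i - 1"]) (auto simp: add.commute)
    thus ?thesis by (simp add: n algebra_simps)
  qed
  have 2: "?x * ?y = complex_of_real (b (int k) * c (int k))" using z by simp
  have 3: "(\<Prod>i<n + 1. e i) = complex_of_real (\<Prod>i<n + 1. b (int i + 1))"
    "(\<Prod>i<n + 1. f i) = complex_of_real (\<Prod>i<n + 1. c (int i + 1))"
    by (simp_all add: e_def f_def)
  have 4: "(- 1) ^ (k + 1) = ((- 1) ^ (n + 1) :: real)" by (simp add: n)
  show ?thesis
    unfolding 1 2 3 g_fun_def A_coeff_def shift 4 by (simp add: algebra_simps)
qed

subsection \<open>Winding of the symbol curve\<close>

text \<open>The radius \<open>q\<close> may be negative, since A' can have either sign; dw/w is i dt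
  along the path in both cases.\<close>

lemma winding_number_circle_real_radius:
  assumes "q \<noteq> 0"
  shows "winding_number (part_circlepath 0 q 0 (2 * pi)) 0 = 1"
proof -
  have "((\<lambda>t. 1 / (0 + complex_of_real q * cis t - 0) * complex_of_real q * \<i> * cis t)
           has_integral (2 * pi - 0) *\<^sub>R \<i>) {0..2 * pi}"
    using assms has_integral_const_real[of "\<i>" 0 "2 * pi"] by simp
  hence "((\<lambda>w. 1 / (w - 0)) has_contour_integral (2 * pi - 0) *\<^sub>R \<i>) (part_circlepath 0 q 0 (2 * pi))"
    by (subst has_contour_integral_part_circlepath_iff) auto
  hence "contour_integral (part_circlepath 0 q 0 (2 * pi)) (\<lambda>w. 1 / (w - 0)) = (2 * pi) *\<^sub>R \<i>"
    using contour_integral_unique by fastforce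
  moreover have "0 \<notin> path_image (part_circlepath 0 q 0 (2 * pi))"
    using assms by (auto simp: path_image_part_circlepath)
  ultimately show ?thesis
    by (subst winding_number_valid_path) (auto simp: scaleR_conv_of_real)
qed

text \<open>These are the points of the segment from the circle point \<open>q cis \<theta>\<close>
  to the corresponding ellipse point. At a zero the imaginary part forces
  \<open>sin \<theta> = 0\<close>; as \<open>p\<close> and \<open>q\<close> have equal signs, the
  real part then gives s|g| = s|p| + |q|, which contradicts |g| < |p| + |q|.\<close>

lemma ellipse_segment_avoids_zero:
  fixes p q g s \<theta> :: real
  assumes "\<bar>g\<bar> < \<bar>p + q\<bar>" "\<bar>p\<bar> < \<bar>q\<bar>" "p * q > 0" "0 \<le> s" "s \<le> 1"
  shows "of_real s * (of_real g + of_real p * cis (- \<theta>)) + of_real q * cis \<theta> \<noteq> 0"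
proof
  assume 0: "of_real s * (of_real g + of_real p * cis (- \<theta>)) + of_real q * cis \<theta> = 0"
  have re: "s * g + (s * p + q) * cos \<theta> = 0"
    using arg_cong[OF 0, of Re] by (simp add: algebra_simps)
  have im: "(q - s * p) * sin \<theta> = 0"
    using arg_cong[OF 0, of Im] by (simp add: algebra_simps)
  have sp: "\<bar>s * p\<bar> < \<bar>q\<bar>"
    using assms mult_left_le_one_le[of "\<bar>p\<bar>" s] by (simp add: abs_mult)
  hence "sin \<theta> = 0" using im by auto
  hence "\<bar>cos \<theta>\<bar> = 1" using sin_cos_squared_add[of \<theta>] by (simp add: abs_square_eq_1)
  moreover have "\<bar>s * g\<bar> = \<bar>(s * p + q) * cos \<theta>\<bar>" using re by linarith
  ultimately have eq: "s * \<bar>g\<bar> = \<bar>s * p + q\<bar>"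
    using assms(4) by (simp add: abs_mult)
  consider "p > 0" "q > 0" | "p < 0" "q < 0"
    using assms(3) by (auto simp: zero_less_mult_iff)
  hence "\<bar>s * p + q\<bar> = s * \<bar>p\<bar> + \<bar>q\<bar> \<and> \<bar>p + q\<bar> = \<bar>p\<bar> + \<bar>q\<bar>"
  proof cases
    case 1
    thus ?thesis using mult_nonneg_nonneg[of s p] assms(4) by simp
  next
    case 2
    thus ?thesis using mult_nonneg_nonpos[of s p] assms(4) by simp
  qed
  hence sgn: "\<bar>s * p + q\<bar> = s * \<bar>p\<bar> + \<bar>q\<bar>" "\<bar>p + q\<bar> = \<bar>p\<bar> + \<bar>q\<bar>" by auto
  have "s > 0" using eq sgn sp assms by (cases "s = 0") auto
  hence "s * \<bar>g\<bar> < s * (\<bar>p\<bar> + \<bar>q\<bar>)" using assms(1) sgn by simp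
  also have "\<dots> \<le> s * \<bar>p\<bar> + \<bar>q\<bar>"
    using assms(4,5) mult_left_le_one_le[of "\<bar>q\<bar>" s] by (simp add: distrib_left)
  finally show False using eq sgn by simp
qed

text \<open>The linear homotopy to the circle of radius \<open>q\<close> never meets 0.\<close>

lemma winding_number_ellipse:
  fixes p q g :: real
  assumes gpq: "\<bar>g\<bar> < \<bar>p + q\<bar>" "\<bar>p\<bar> < \<bar>q\<bar>" "p * q > 0"
  defines "\<gamma> \<equiv> \<lambda>t. of_real g + of_real p * cis (- (2 * pi * t)) + of_real q * cis (2 * pi * t)"
  shows "winding_number \<gamma> 0 = 1"
proof -
  let ?C = "part_circlepath 0 q 0 (2 * pi)"
  have C: "?C t = of_real q * cis (2 * pi * t)" for t
    by (simp add: part_circlepath_def linepath_def cis_conv_exp mult_ac)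
  have "homotopic_loops (- {0}) ?C \<gamma>"
  proof (rule homotopic_loops_linear)
    show "path \<gamma>" unfolding path_def \<gamma>_def
      by (intro continuous_intros) 
    show "pathfinish \<gamma> = pathstart \<gamma>" 
      by (simp add: pathfinish_def pathstart_def \<gamma>_def complex_eq_iff)
    fix t :: real
    show "closed_segment (?C t) (\<gamma> t) \<subseteq> - {0}"
    proof
      fix x assume "x \<in> closed_segment (?C t) (\<gamma> t)"
      then obtain s where s: "0 \<le> s" "s \<le> 1" "x = (1 - s) *\<^sub>R ?C t + s *\<^sub>R \<gamma> t"
        by (auto simp: closed_segment_def)
      hence "x = of_real s * (of_real g + of_real p * cis (- (2 * pi * t))) + of_real q * cis (2 * pi * t)"
        unfolding C by (simp add: \<gamma>_def scaleR_conv_of_real algebra_simps)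
      thus "x \<in> - {0}" using ellipse_segment_avoids_zero[OF gpq s(1,2)] by simp
    qed
  qed (auto simp: exp_eq_1)
  hence "winding_number ?C 0 = winding_number \<gamma> 0"
    by (rule winding_number_homotopic_loops)
  thus ?thesis using winding_number_circle_real_radius[of q] gpq by auto
qed

lemma Re_arcosh_of_real:
  fixes x :: real
  assumes "\<bar>x\<bar> > 1"
  shows "\<bar>Re (arcosh (complex_of_real (- x)))\<bar> = arcosh \<bar>x\<bar>"
proof -
  define s where "s = sqrt (x\<^sup>2 - 1)"
  have x2: "x\<^sup>2 > 1" using assms by (metis one_less_power power2_abs zero_less_numeral)
  have "((complex_of_real (- x))\<^sup>2 - 1) powr of_real (1/2) = of_real ((x\<^sup>2 - 1) powr (1/2))"
    using x2 by (subst powr_of_real[symmetric]) auto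
  hence ar: "arcosh (complex_of_real (- x)) = ln (of_real (- x + s))"
    using x2 unfolding arcosh_def by (simp add: powr_half_sqrt s_def del: of_real_power)
  have s2: "s\<^sup>2 = x\<^sup>2 - 1" using x2 by (simp add: s_def)
  have s0: "s > 0" using x2 by (simp add: s_def)
  \<comment> \<open>The argument of the logarithm has modulus |x| + s or |x| - s according to the
    sign of \<open>x\<close>; these are reciprocal, so the absolute value of the logarithm is the
    same.\<close>
  have prod: "(\<bar>x\<bar> - s) * (\<bar>x\<bar> + s) = 1"
    using s2 by (simp add: algebra_simps power2_eq_square)
  have pos: "\<bar>x\<bar> + s > 1" using assms s0 by simp
  hence pos2: "\<bar>x\<bar> - s > 0" using prod zero_less_mult_pos2[of "\<bar>x\<bar> - s" "\<bar>x\<bar> + s"] by simp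
  have inv: "ln (\<bar>x\<bar> - s) = - ln (\<bar>x\<bar> + s)"
    using prod pos pos2 ln_mult_pos[of "\<bar>x\<bar> - s" "\<bar>x\<bar> + s"] by simp
  have nz: "- x + s \<noteq> 0" using pos pos2 by (cases "x \<ge> 0") auto
  have "Re (ln (complex_of_real (- x + s))) = ln \<bar>- x + s\<bar>"
    using nz by (metis Re_Ln norm_of_real of_real_eq_0_iff)
  moreover have "\<bar>ln \<bar>- x + s\<bar>\<bar> = ln (\<bar>x\<bar> + s)"
  proof (cases "x \<ge> 0")
    case True
    hence "\<bar>- x + s\<bar> = \<bar>x\<bar> - s" using pos2 by simp
    thus ?thesis using inv pos by simp
  next
    case False
    hence "\<bar>- x + s\<bar> = \<bar>x\<bar> + s" using s0 by simp
    thus ?thesis using pos by simp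
  qed
  moreover have "arcosh \<bar>x\<bar> = ln (\<bar>x\<bar> + s)"
    using assms by (simp add: arcosh_real_def s_def)
  ultimately show ?thesis unfolding ar by simp
qed

section \<open>From the spectral hypotheses to the roots of the determinant\<close>

lemma A_coeff_ratio:
  assumes "\<And>i. b i * c i > 0" "(\<Prod>i=1..k. b (int i) / c (int i)) > 1"
  shows "A_coeff k b = A_coeff k c * exp (2 * r_rate k b c)" "A_coeff k c \<noteq> 0" "r_rate k b c > 0"
proof -
  have c: "c i \<noteq> 0" for i using assms(1)[of i] by auto
  show "A_coeff k c \<noteq> 0" using c by (simp add: A_coeff_def)
  show "r_rate k b c > 0" using assms(2) by (simp add: r_rate_def)
  have "exp (2 * r_rate k b c) = (\<Prod>i=1..k. b (int i)) / (\<Prod>i=1..k. c (int i))"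
    using assms(2) by (simp add: r_rate_def prod_dividef)
  thus "A_coeff k b = A_coeff k c * exp (2 * r_rate k b c)"
    using c by (simp add: A_coeff_def)
qed

text \<open>The symbol curve is an ellipse with centre g on the real axis and real semi-axis |A +
  A'|. Equality would put 0 on the curve, hence \<open>lam\<close> in \<open>sigma_det\<close>; the
  reverse strict inequality would put 0 inside with winding number 1, hence \<open>lam\<close> in
  \<open>sigma_wind\<close>.\<close>

lemma abs_g_fun_gt:
  assumes k: "k \<ge> 1" and bc: "\<And>i. b i * c i > 0" and prod: "(\<Prod>i=1..k. b (int i) / c (int i)) > 1"
    and lam: "lam \<notin> sigma_wind k a b c" "lam \<notin> sigma_det k a b c"
  shows "\<bar>g_fun k a b c lam\<bar> > \<bar>A_coeff k c + A_coeff k b\<bar>"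
proof -
  let ?g = "g_fun k a b c lam" and ?A = "A_coeff k c" and ?A' = "A_coeff k b"
  let ?r = "r_rate k b c"
  note AA = A_coeff_ratio[OF bc prod]
  have nz: "symbol_det k a b c lam z \<noteq> 0" if "cmod z = 1" for z
    using lam(2) that by (auto simp: sigma_det_def)
  have "\<bar>?g\<bar> \<noteq> \<bar>?A + ?A'\<bar>"
  proof
    assume "\<bar>?g\<bar> = \<bar>?A + ?A'\<bar>"
    \<comment> \<open>The two cases are zeros of the determinant at z = 1 and at z = -1.\<close>
    hence "?g + ?A + ?A' = 0 \<or> ?g - ?A - ?A' = 0" by linarith
    moreover have "symbol_det k a b c lam 1 = complex_of_real (?g + ?A + ?A')"
      "symbol_det k a b c lam (- 1) = complex_of_real (?g - ?A - ?A')"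
      by (simp_all add: symbol_det_eq[OF k])
    ultimately show False using nz[of 1] nz[of "- 1"]
      by (metis norm_minus_cancel norm_one of_real_0)
  qed
  moreover have "\<not> \<bar>?g\<bar> < \<bar>?A + ?A'\<bar>"
  proof
    assume less: "\<bar>?g\<bar> < \<bar>?A + ?A'\<bar>"
    have "\<bar>?A'\<bar> = \<bar>?A\<bar> * exp (2 * ?r)" by (simp only: AA(1) abs_mult) simp
    moreover have "exp (2 * ?r) > 1" using AA(3) by simp
    ultimately have abs: "\<bar>?A\<bar> < \<bar>?A'\<bar>" using AA(2) by simp
    have "?A * ?A' = ?A\<^sup>2 * exp (2 * ?r)" by (simp only: AA(1) power2_eq_square mult.assoc)
    hence pos: "?A * ?A' > 0" using AA(2) by simp
    \<comment> \<open>Evaluating at exp(-i theta) attaches A' to the positively rotating term; since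
      |A'| > |A|, the curve runs counterclockwise.\<close>
    have "symbol_curve k a b c lam
       = (\<lambda>t. of_real ?g + of_real ?A * cis (- (2 * pi * t)) + of_real ?A' * cis (2 * pi * t))"
    proof
      fix t
      have "exp (- \<i> * complex_of_real (2 * pi * t)) = cis (- (2 * pi * t))"
        by (simp add: cis_conv_exp)
      thus "symbol_curve k a b c lam t
       = of_real ?g + of_real ?A * cis (- (2 * pi * t)) + of_real ?A' * cis (2 * pi * t)"
        unfolding symbol_curve_def by (simp add: symbol_det_eq[OF k])
    qed
    hence "winding_number (symbol_curve k a b c lam) 0 = 1"
      using winding_number_ellipse[OF less abs pos] by simp
    moreover have "cmod (exp (- \<i> * complex_of_real (2 * pi * t))) = 1" for t by simp
    hence "0 \<notin> path_image (symbol_curve k a b c lam)"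
      using nz by (force simp: path_image_def symbol_curve_def)
    ultimately show False using lam(1) by (simp add: sigma_wind_def)
  qed
  ultimately show ?thesis by linarith
qed

text \<open>Since A' = A exp(2r), substituting z = sigma exp(r + y) with sigma = 1 or -1 turns the
  determinant into 2 A exp(r) (x + sigma cosh y). It vanishes when sigma has the sign opposite to
  \<open>x\<close> and y is plus or minus beta = arcosh |x|.\<close>

lemma symbol_det_roots:
  assumes k: "k \<ge> 1" and bc: "\<And>i. b i * c i > 0" and prod: "(\<Prod>i=1..k. b (int i) / c (int i)) > 1"
    and lam: "lam \<notin> sigma_wind k a b c" "lam \<notin> sigma_det k a b c"
  defines "x \<equiv> g_fun k a b c lam / (2 * A_coeff k c * exp (r_rate k b c))"
  shows "beta_tilde k a b c lam = arcosh \<bar>x\<bar>" "B_rate k a b c lam > 0"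
    "\<exists>z z'. symbol_det k a b c lam z = 0 \<and> symbol_det k a b c lam z' = 0 \<and>
       cmod z = exp (- B_rate k a b c lam) \<and> cmod z' = exp (r_rate k b c + beta_tilde k a b c lam)"
proof -
  let ?g = "g_fun k a b c lam" and ?A = "A_coeff k c" and ?A' = "A_coeff k b"
  let ?r = "r_rate k b c"
  note AA = A_coeff_ratio[OF bc prod]
  \<comment> \<open>Hence A + A' = 2 A exp(r) cosh(r), and the bound on g becomes |x| > cosh r, that
    is beta > r.\<close>
  have "2 * exp ?r * cosh ?r = 1 + exp (2 * ?r)"
    by (simp add: cosh_def distrib_left mult_exp_exp)
  hence "?A + ?A' = 2 * ?A * exp ?r * cosh ?r"
    unfolding AA(1) by (metis distrib_left mult.assoc mult.left_commute mult.right_neutral)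
  hence "\<bar>2 * ?A * exp ?r\<bar> * cosh ?r < \<bar>?g\<bar>"
    using abs_g_fun_gt[OF k bc prod lam] by (simp add: abs_mult)
  moreover have "\<bar>2 * ?A * exp ?r\<bar> > 0" using AA(2) by simp
  ultimately have "\<bar>x\<bar> > cosh ?r"
    unfolding x_def abs_divide by (metis mult.commute pos_less_divide_eq)
  hence x: "\<bar>x\<bar> > cosh ?r" "\<bar>x\<bar> > 1" using cosh_real_ge_1[of ?r] by auto
  show beta: "beta_tilde k a b c lam = arcosh \<bar>x\<bar>"
    unfolding beta_tilde_def x_def[symmetric] by (rule Re_arcosh_of_real[OF x(2)])
  have "arcosh (cosh ?r) < arcosh \<bar>x\<bar>"
    using x by (intro arcosh_real_strict_mono) (auto simp: cosh_real_ge_1)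
  thus B: "B_rate k a b c lam > 0" using AA(3) by (simp add: B_rate_def beta arcosh_cosh_real)
  define \<sigma> :: real where "\<sigma> = (if x > 0 then - 1 else 1)"
  define \<beta> where "\<beta> = beta_tilde k a b c lam"
  have cosh: "cosh \<beta> = \<bar>x\<bar>" using x by (simp add: \<beta>_def beta)
  have \<sigma>: "inverse \<sigma> = \<sigma>" "\<bar>\<sigma>\<bar> = 1" "x + \<sigma> * \<bar>x\<bar> = 0" by (auto simp: \<sigma>_def)
  have root: "symbol_det k a b c lam (complex_of_real (\<sigma> * exp (?r + y))) = 0"
    if "cosh y = \<bar>x\<bar>" for y
  proof -
    have "?g + ?A * (\<sigma> * exp (?r + y)) + ?A' * inverse (\<sigma> * exp (?r + y))
        = ?g + 2 * ?A * exp ?r * (\<sigma> * cosh y)"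
    proof -
      have "exp (2 * ?r) * inverse (exp (?r + y)) = exp ?r * exp (- y)"
        by (simp flip: exp_add exp_minus)
      hence "?A' * inverse (\<sigma> * exp (?r + y)) = ?A * \<sigma> * (exp ?r * exp (- y))"
        unfolding AA(1) by (simp only: inverse_mult_distrib \<sigma>(1)) (simp add: mult_ac)
      thus ?thesis by (simp add: cosh_def exp_add algebra_simps)
    qed
    also have "\<dots> = 2 * ?A * exp ?r * (x + \<sigma> * \<bar>x\<bar>)"
      using AA(2) that by (simp add: x_def algebra_simps)
    finally have "?g + ?A * (\<sigma> * exp (?r + y)) + ?A' * inverse (\<sigma> * exp (?r + y)) = 0"
      by (simp add: \<sigma>(3))
    moreover have "complex_of_real (\<sigma> * exp (?r + y)) \<noteq> 0" using \<sigma>(2) by auto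
    ultimately show ?thesis
      by (metis (no_types, lifting) symbol_det_eq[OF k] of_real_0 of_real_add of_real_inverse of_real_mult)
  qed
  have norm: "cmod (complex_of_real (\<sigma> * exp t)) = exp t" for t
    using \<sigma>(2) by (simp only: norm_of_real abs_mult) simp
  \<comment> \<open>The choice y = -beta has modulus exp(r - beta) = exp(-B), and y = beta has
    modulus exp(r + beta).\<close>
  show "\<exists>z z'. symbol_det k a b c lam z = 0 \<and> symbol_det k a b c lam z' = 0 \<and>
       cmod z = exp (- B_rate k a b c lam) \<and> cmod z' = exp (r_rate k b c + beta_tilde k a b c lam)"
    using root[of "- \<beta>"] root[of \<beta>] cosh norm[of "?r + - \<beta>"] norm[of "?r + \<beta>"]
    by (intro exI[of _ "complex_of_real (\<sigma> * exp (?r + - \<beta>))"] exI[of _ "complex_of_real (\<sigma> * exp (?r + \<beta>))"])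
      (simp add: \<beta>_def B_rate_def)
qed

subsection \<open>Floquet solutions of the periodic recurrence\<close>

lemma k_periodic_int_mult:
  assumes "k_periodic k h"
  shows "h (i + int k * q) = h i"
proof (induction q rule: int_induct[of _ 0])
  case (step1 q)
  have "h (i + int k * (q + 1)) = h ((i + int k * q) + int k)" by (simp add: algebra_simps)
  thus ?case using step1 assms unfolding k_periodic_def by simp
next
  case (step2 q)
  have "h (i + int k * q) = h ((i + int k * (q - 1)) + int k)" by (simp add: algebra_simps)
  thus ?case using step2 assms unfolding k_periodic_def by simp
qed simp

lemma k_periodic_bounded:
  assumes "k_periodic k h" "k \<ge> 1"
  shows "\<bar>h i\<bar> \<le> (\<Sum>j<k. \<bar>h (int j)\<bar>)"
proof -
  have "h i = h (i mod int k)"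
    using k_periodic_int_mult[OF assms(1), of "i mod int k" "i div int k"] by simp
  moreover have "i mod int k = int (nat (i mod int k))" "nat (i mod int k) < k"
    using assms(2) by (auto simp: nat_less_iff)
  ultimately show ?thesis
    using member_le_sum[of "nat (i mod int k)" "{..<k}" "\<lambda>j. \<bar>h (int j)\<bar>"] by auto
qed

lemma symbol_shift_carrier:
  "symbol k a b c z - complex_of_real lam \<cdot>\<^sub>m 1\<^sub>m k \<in> carrier_mat k k"
  by (intro carrier_matI) (simp_all add: symbol_def A_zero_def A_minus_def A_plus_def)

text \<open>Position \<open>s\<close> stands for site \<open>s + 1\<close> of a period. A row is the
  three-term expression at that site, with neighbours wrapped around the period: a step out to the
  right costs a factor 1/z, a step out to the left a factor z.\<close>

lemma symbol_row:
  fixes v :: "complex vec"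
  assumes v: "v \<in> carrier_vec k" and s: "s < k"
  shows "((symbol k a b c z - complex_of_real lam \<cdot>\<^sub>m 1\<^sub>m k) *\<^sub>v v) $ s
    = complex_of_real (a (int s + 1) - lam) * v $ s
      + (if s + 1 < k then b (int s + 1) * v $ (s + 1) else b (int k) * inverse z * v $ 0)
      + (if s \<ge> 1 then c (int s) * v $ (s - 1) else c (int k) * z * v $ (k - 1))"
proof -
  let ?M = "symbol k a b c z - complex_of_real lam \<cdot>\<^sub>m 1\<^sub>m k"
  note M = symbol_shift_carrier[of k a b c z lam]
  have "(?M *\<^sub>v v) $ s = (\<Sum>j<k. ?M $$ (s, j) * v $ j)"
    using M v s by (auto simp: scalar_prod_def atLeast0LessThan intro!: sum.cong)
  \<comment> \<open>The entries are kept as separate single-column terms because for small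
    \<open>k\<close> several of them share a column. The guard \<open>s \<ge> 1\<close> neutralises
    the truncated subtraction in \<open>s - 1\<close>.\<close>
  also have "\<dots> = (\<Sum>j<k. (if j = s then complex_of_real (a (int s + 1) - lam) * v $ s else 0)
      + (if j = s + 1 then b (int s + 1) * v $ (s + 1) else 0)
      + (if j = s - 1 then (if s \<ge> 1 then c (int s) * v $ (s - 1) else 0) else 0)
      + (if j = 0 then (if s = k - 1 then b (int k) * inverse z * v $ 0 else 0) else 0)
      + (if j = k - 1 then (if s = 0 then c (int k) * z * v $ (k - 1) else 0) else 0))"
    by (rule sum.cong)
      (use s in \<open>auto simp: symbol_def A_zero_def A_minus_def A_plus_def algebra_simps of_nat_diff\<close>)
  also have "\<dots> = complex_of_real (a (int s + 1) - lam) * v $ s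
      + (if s + 1 < k then b (int s + 1) * v $ (s + 1) else b (int k) * inverse z * v $ 0)
      + (if s \<ge> 1 then c (int s) * v $ (s - 1) else c (int k) * z * v $ (k - 1))"
    using s by (auto simp: sum.distrib)
  finally show ?thesis .
qed

text \<open>A kernel vector of the shifted symbol supplies the values on one period; continuing it
  with the factor 1/z per period gives a solution on all of Z.\<close>

lemma floquet_solution:
  assumes k: "k \<ge> 1" and per: "k_periodic k a" "k_periodic k b" "k_periodic k c"
    and z: "z \<noteq> 0" and det: "symbol_det k a b c lam z = 0"
  obtains \<phi> :: "int \<Rightarrow> complex" where
    "\<And>i. c (i - 1) * \<phi> (i - 1) + complex_of_real (a i - lam) * \<phi> i + b i * \<phi> (i + 1) = 0"
    "\<And>i q. \<phi> (i + int k * q) = \<phi> i * z powi (- q)"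
    "\<exists>i. \<phi> i \<noteq> 0"
proof -
  let ?M = "symbol k a b c z - complex_of_real lam \<cdot>\<^sub>m 1\<^sub>m k"
  obtain v where v: "v \<in> carrier_vec k" "v \<noteq> 0\<^sub>v k" "?M *\<^sub>v v = 0\<^sub>v k"
    
    using det det_0_iff_vec_prod_zero[OF symbol_shift_carrier] unfolding symbol_det_def by blast
  \<comment> \<open>Site 1 carries \<open>v $ 0\<close>, hence the shift by one; \<open>div\<close>
    counts the periods, also the negative ones.\<close>
  define \<phi> where "\<phi> i = v $ nat ((i - 1) mod int k) * z powi (- ((i - 1) div int k))" for i
  have quasi: "\<phi> (i + int k * q) = \<phi> i * z powi (- q)" for i q
  proof -
    have shift: "i + int k * q - 1 = i - 1 + int k * q" by simp
    have "\<phi> (i + int k * q) = v $ nat ((i - 1) mod int k) * z powi (- q + - ((i - 1) div int k))"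
      unfolding \<phi>_def shift using k by simp
    thus ?thesis using z by (subst (asm) power_int_add) (auto simp: \<phi>_def)
  qed
  have base: "c (int s) * \<phi> (int s) + complex_of_real (a (int s + 1) - lam) * \<phi> (int s + 1)
      + b (int s + 1) * \<phi> (int s + 2) = 0" if s: "s < k" for s
  proof -
    have 1: "\<phi> (int s + 1) = v $ s" using s by (simp add: \<phi>_def)
    have 2: "b (int s + 1) * \<phi> (int s + 2)
        = (if s + 1 < k then b (int s + 1) * v $ (s + 1) else b (int k) * inverse z * v $ 0)"
    proof (cases "s + 1 < k")
      case True
      hence "(int s + 1) mod int k = int s + 1" "(int s + 1) div int k = 0" by auto
      thus ?thesis using True by (simp add: \<phi>_def nat_add_distrib)
    next
      case False
      hence "int s + 1 = int k" "int s + 2 = int k + 1" using s by simp_all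
      moreover have "\<phi> (int k + 1) = inverse z * v $ 0" using k by (simp add: \<phi>_def power_int_minus)
      ultimately show ?thesis using False by (simp only: if_False mult.assoc)
    qed
    have 3: "c (int s) * \<phi> (int s)
        = (if s \<ge> 1 then c (int s) * v $ (s - 1) else c (int k) * z * v $ (k - 1))"
    proof (cases "s \<ge> 1")
      case True
      hence "(int s - 1) mod int k = int s - 1" "(int s - 1) div int k = 0" using s by auto
      thus ?thesis using True by (simp add: \<phi>_def nat_diff_distrib)
    next
      \<comment> \<open>Here \<open>s = 0\<close>: site 0 is the last site of the preceding period,
        and the quotient -1 yields the factor \<open>z\<close>.\<close>
      case False
      have "(- 1) mod int k = int k - 1" "(- 1) div int k = - 1"
        using k by (auto simp: zmod_minus1 div_eq_minus1)
      moreover have "c (int k) = c 0" using per(3) unfolding k_periodic_def by (metis add_0)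
      moreover have "nat (int k - 1) = k - 1" by simp
      moreover have "s = 0" using False by simp
      ultimately show ?thesis by (simp add: \<phi>_def)
    qed
    have "(?M *\<^sub>v v) $ s = 0" using v s by simp
    thus ?thesis using symbol_row[OF v(1) s, of a b c z lam] unfolding 1 2 3 
      by (simp add: algebra_simps)
  qed
  show thesis
  proof (rule that)
    fix i :: int
    \<comment> \<open>Site \<open>i\<close> is site \<open>s + 1\<close> moved by \<open>q\<close>
      periods, so its relation is the one on the base period times a common power of
      \<open>z\<close>.\<close>
    define s q where "s = nat ((i - 1) mod int k)" and "q = (i - 1) div int k"
    have s: "s < k" "int s = (i - 1) mod int k" using k by (auto simp: s_def nat_less_iff)
    have i: "i = int s + 1 + int k * q" unfolding s(2) q_def by simp
    have "i - 1 = int s + int k * q" "i + 1 = int s + 2 + int k * q" using i by auto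
    hence "c (i - 1) * \<phi> (i - 1) + complex_of_real (a i - lam) * \<phi> i + b i * \<phi> (i + 1)
       = (c (int s) * \<phi> (int s) + complex_of_real (a (int s + 1) - lam) * \<phi> (int s + 1)
      + b (int s + 1) * \<phi> (int s + 2)) * z powi (- q)"
      using per by (simp only: i quasi k_periodic_int_mult) (simp add: algebra_simps)
    thus "c (i - 1) * \<phi> (i - 1) + complex_of_real (a i - lam) * \<phi> i + b i * \<phi> (i + 1) = 0"
      using base[OF s(1)] by simp
  next
    show "\<exists>i. \<phi> i \<noteq> 0"
    proof -
      obtain s where s: "s < k" "v $ s \<noteq> 0" using v(1,2) by (metis carrier_vecD eq_vecI index_zero_vec)
      hence "\<phi> (int s + 1) \<noteq> 0" by (simp add: \<phi>_def)
      thus ?thesis ..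
    qed
  qed (rule quasi)
qed

section \<open>Bounded solutions of three-term recurrences on a half-line\<close>

lemma three_term_unique:
  fixes h :: "nat \<Rightarrow> complex"
  assumes "\<And>n. S n \<noteq> 0" "\<And>n. P n * h n + Q n * h (n + 1) + S n * h (n + 2) = 0"
    and "h 0 = 0" "h 1 = 0"
  shows "h n = 0"
proof -
  have "h n = 0 \<and> h (n + 1) = 0"
  proof (induction n)
    case (Suc n)
    thus ?case using assms(1,2)[of n] by simp
  qed (use assms in simp)
  thus ?thesis ..
qed

text \<open>Different multipliers make \<open>\<phi>\<close> and \<open>\<psi>\<close> a basis of
  the two-dimensional solution space. A component along the growing \<open>\<phi>\<close> would make
  \<open>u\<close> unbounded, so \<open>u\<close> is a multiple of \<open>\<psi>\<close> and
  inherits its multiplier.\<close>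

lemma bounded_solution_decays:
  fixes \<phi> \<psi> u :: "nat \<Rightarrow> complex"
  assumes S: "\<And>n. S n \<noteq> 0"
    and rec: "\<And>n. P n * \<phi> n + Q n * \<phi> (n + 1) + S n * \<phi> (n + 2) = 0"
      "\<And>n. P n * \<psi> n + Q n * \<psi> (n + 1) + S n * \<psi> (n + 2) = 0"
      "\<And>n. P n * u n + Q n * u (n + 1) + S n * u (n + 2) = 0"
    and quasi: "\<And>n. \<phi> (n + k) = w * \<phi> n" "\<And>n. \<psi> (n + k) = w' * \<psi> n"
    and nz: "\<exists>n. \<phi> n \<noteq> 0" "\<exists>n. \<psi> n \<noteq> 0"
    and w: "cmod w > 1" "cmod w' \<le> 1" and bdd: "\<And>n. cmod (u n) \<le> K"
  shows "u (n + k) = w' * u n"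
proof -
  have lin: "P n * (x * \<phi> n + y * \<psi> n + t * u n) + Q n * (x * \<phi> (n + 1) + y * \<psi> (n + 1) + t * u (n + 1))
      + S n * (x * \<phi> (n + 2) + y * \<psi> (n + 2) + t * u (n + 2)) = 0" for x y t n
  proof -
    have "P n * (x * \<phi> n + y * \<psi> n + t * u n) + Q n * (x * \<phi> (n + 1) + y * \<psi> (n + 1) + t * u (n + 1))
      + S n * (x * \<phi> (n + 2) + y * \<psi> (n + 2) + t * u (n + 2))
      = x * (P n * \<phi> n + Q n * \<phi> (n + 1) + S n * \<phi> (n + 2))
        + y * (P n * \<psi> n + Q n * \<psi> (n + 1) + S n * \<psi> (n + 2))
        + t * (P n * u n + Q n * u (n + 1) + S n * u (n + 2))"
      by (simp add: algebra_simps)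
    thus ?thesis by (simp only: rec mult_zero_right add_0_right)
  qed
  have uniq: "x * \<phi> n + y * \<psi> n + t * u n = 0"
    if "x * \<phi> 0 + y * \<psi> 0 + t * u 0 = 0" "x * \<phi> 1 + y * \<psi> 1 + t * u 1 = 0" for x y t n
    by (rule three_term_unique[OF S lin that])
  have ww: "w \<noteq> w'" using w by auto
  \<comment> \<open>A relation valid at 0 and 1 is valid everywhere; comparing it at
    \<open>n\<close> and \<open>n + k\<close> separates the two terms, because
    \<open>w \<noteq> w'\<close>.\<close>
  have indep: "x = 0 \<and> y = 0"
    if "x * \<phi> 0 + y * \<psi> 0 = 0" "x * \<phi> 1 + y * \<psi> 1 = 0" for x y
  proof -
    have 0: "x * \<phi> n + y * \<psi> n = 0" for n using uniq[of x y 0 n] that by simp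
    have 1: "x * (w * \<phi> n) + y * (w' * \<psi> n) = 0" for n using 0[of "n + k"] by (simp add: quasi)
    have "x * (w - w') * \<phi> n = (x * (w * \<phi> n) + y * (w' * \<psi> n)) - w' * (x * \<phi> n + y * \<psi> n)"
      "y * (w - w') * \<psi> n = w * (x * \<phi> n + y * \<psi> n) - (x * (w * \<phi> n) + y * (w' * \<psi> n))" for n
      by (simp_all add: algebra_simps)
    hence "x * (w - w') * \<phi> n = 0" "y * (w - w') * \<psi> n = 0" for n
      using 0 1 by simp_all
    thus ?thesis using ww nz by auto
  qed
  \<comment> \<open>This is the Casoratian, the discrete Wronskian; the coefficients
    \<open>x\<close>, \<open>y\<close> below come from Cramer's rule.\<close>
  define D where "D = \<phi> 0 * \<psi> 1 - \<phi> 1 * \<psi> 0"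
  have D: "D \<noteq> 0"
  proof
    assume "D = 0"
    hence "\<psi> 0 = 0 \<and> - \<phi> 0 = 0" "\<psi> 1 = 0 \<and> - \<phi> 1 = 0"
      by (intro indep; simp add: D_def algebra_simps)+
    thus False using indep[of 1 0] by simp
  qed
  define x y where "x = (u 0 * \<psi> 1 - u 1 * \<psi> 0) / D" and "y = (\<phi> 0 * u 1 - \<phi> 1 * u 0) / D"
  have "x * \<phi> 0 + y * \<psi> 0 + (- 1) * u 0 = 0" "x * \<phi> 1 + y * \<psi> 1 + (- 1) * u 1 = 0"
    using D by (simp_all add: x_def y_def field_simps) (simp_all add: D_def algebra_simps)
  hence "x * \<phi> n + y * \<psi> n + (- 1) * u n = 0" for n by (rule uniq)
  hence u: "u n = x * \<phi> n + y * \<psi> n" for n by (simp add: algebra_simps)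
  have iter: "\<phi> (n + j * k) = w ^ j * \<phi> n" "\<psi> (n + j * k) = w' ^ j * \<psi> n" for n j
  proof (induction j)
    case (Suc j)
    have "n + Suc j * k = (n + j * k) + k" by simp
    thus "\<phi> (n + Suc j * k) = w ^ Suc j * \<phi> n" "\<psi> (n + Suc j * k) = w' ^ Suc j * \<psi> n"
      using Suc by (simp_all only: quasi) simp_all
  qed simp_all
  have "x = 0"
  proof (rule ccontr)
    assume "x \<noteq> 0"
    obtain n where n: "\<phi> n \<noteq> 0" using nz by blast
    let ?d = "cmod (x * \<phi> n)"
    have d: "?d > 0" using n \<open>x \<noteq> 0\<close> by simp
    \<comment> \<open>After \<open>j\<close> periods the growing component alone exceeds the bound
      on \<open>u\<close> plus that on the \<open>\<psi>\<close> component.\<close>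
    obtain j where j: "(K + cmod (y * \<psi> n)) / ?d < cmod w ^ j"
      using real_arch_pow[OF w(1)] by blast
    have "w ^ j * (x * \<phi> n) = u (n + j * k) - w' ^ j * (y * \<psi> n)"
      unfolding u iter by (simp add: algebra_simps)
    hence "cmod w ^ j * ?d \<le> cmod (u (n + j * k)) + cmod (w' ^ j * (y * \<psi> n))"
      by (metis norm_mult norm_power norm_triangle_ineq4)
    also have "\<dots> \<le> K + 1 * cmod (y * \<psi> n)"
      unfolding norm_mult[of "w' ^ j"] norm_power using w(2)
      by (intro add_mono bdd mult_right_mono power_le_one) auto
    finally show False using j d by (simp add: field_simps)
  qed
  thus ?thesis by (simp add: u quasi)
qed

lemma quasi_periodic_norm_bound:
  fixes u :: "nat \<Rightarrow> complex"
  assumes k: "k \<ge> 1" and "\<And>n. u (n + k) = w * u n"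
  shows "cmod (u n) \<le> (\<Sum>j<k. cmod (u j)) * cmod w ^ (n div k)"
proof -
  have "u (r + j * k) = w ^ j * u r" for r j
  proof (induction j)
    case (Suc j)
    have "r + Suc j * k = (r + j * k) + k" by simp
    thus ?case using Suc by (simp only: assms(2)) simp
  qed simp
  from this[of "n mod k" "n div k"]
  have "cmod (u n) = cmod w ^ (n div k) * cmod (u (n mod k))"
    by (simp add: norm_mult norm_power)
  also have "\<dots> \<le> cmod w ^ (n div k) * (\<Sum>j<k. cmod (u j))"
    using k by (intro mult_left_mono member_le_sum) auto
  finally show ?thesis by (simp add: mult.commute)
qed

text \<open>A nonzero value recurs in every period, hence on both half-lines ending at
  \<open>m\<close>; a shift by |m - i| periods is far enough because
  \<open>k \<ge> 1\<close>.\<close>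

lemma quasi_periodic_nonzero:
  fixes \<phi> :: "int \<Rightarrow> complex"
  assumes k: "k \<ge> 1" and z: "z \<noteq> 0" and quasi: "\<And>i q. \<phi> (i + int k * q) = \<phi> i * z powi (- q)"
    and nz: "\<exists>i. \<phi> i \<noteq> 0"
  shows "\<exists>n. \<phi> (m + int n) \<noteq> 0" "\<exists>n. \<phi> (m - int n) \<noteq> 0"
proof -
  obtain i where i: "\<phi> i \<noteq> 0" using nz by blast
  have nz': "\<phi> (i + int k * q) \<noteq> 0" for q using i z by (simp add: quasi)
  define t where "t = int k * \<bar>m - i\<bar>"
  have "t \<ge> 1 * \<bar>m - i\<bar>" unfolding t_def using k by (intro mult_right_mono) auto
  hence "i + t = m + int (nat (i + t - m))" "i - t = m - int (nat (m - i + t))" by simp_all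
  moreover have "i + t = i + int k * \<bar>m - i\<bar>" "i - t = i + int k * (- \<bar>m - i\<bar>)"
    by (simp_all add: t_def)
  ultimately show "\<exists>n. \<phi> (m + int n) \<noteq> 0" "\<exists>n. \<phi> (m - int n) \<noteq> 0" using nz' by metis+
qed

subsection \<open>Truncation\<close>

lemma norm2_smult: "norm2 (x \<cdot>\<^sub>v v) = cmod x * norm2 v"
proof -
  have "norm2 (x \<cdot>\<^sub>v v) = L2_set (\<lambda>i. cmod x * cmod (v $ i)) {..<dim_vec v}"
    unfolding norm2_def by (rule L2_set_cong) (auto simp: norm_mult)
  thus ?thesis by (simp add: norm2_def L2_set_right_distrib)
qed

lemma norm_index_le_norm2: "i < dim_vec v \<Longrightarrow> cmod (v $ i) \<le> norm2 v"
  unfolding norm2_def by (rule member_le_L2_set) auto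

lemma norm2_le_sum: "norm2 v \<le> (\<Sum>i<dim_vec v. cmod (v $ i))"
  unfolding norm2_def by (rule L2_set_le_sum) auto

lemma bi_apply_tridiagonal:
  assumes "\<And>j. j \<notin> {i - 1, i, i + 1} \<Longrightarrow> M i j = 0"
  shows "bi_apply M u i = (\<Sum>j\<in>{i - 1, i, i + 1}. of_real (M i j) * u j)"
proof -
  have "bi_apply M u i = infsum (\<lambda>j. of_real (M i j) * u j) {i - 1, i, i + 1}"
    unfolding bi_apply_def by (rule infsum_cong_neutral) (use assms in auto)
  thus ?thesis by simp
qed

text \<open>The sites \<open>l\<close> and \<open>r\<close> are the neighbours just outside the
  window. Truncation drops only their two columns from the eigenvalue equation, and the band
  structure confines these to the first and the last row.\<close>

lemma truncated_row:
  fixes M :: "int \<Rightarrow> int \<Rightarrow> real" and u :: "int \<Rightarrow> complex" and m :: int and N :: nat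
  assumes tri: "\<And>i j. j \<notin> {i - 1, i, i + 1} \<Longrightarrow> M i j = 0"
    and eig: "bi_apply M u = (\<lambda>i. \<mu> * u i)" and i: "i < N"
  defines "l \<equiv> m - int (N div 2)" and "r \<equiv> m - int (N div 2) + int N + 1"
  shows "((map_mat complex_of_real (trunc_mat m N M) - \<mu> \<cdot>\<^sub>m 1\<^sub>m N) *\<^sub>v trunc_vec m N u) $ i
    = - (if i = 0 then of_real (M (l + 1) l) * u l else 0) - (if i = N - 1 then of_real (M (r - 1) r) * u r else 0)"
proof -
  let ?t = "trunc_index m N"
  let ?f = "\<lambda>j. complex_of_real (M (?t i) j) * u j"
  have t: "?t j = l + 1 + int j" for j by (simp add: trunc_index_def l_def)
  have img: "?t ` {..<N} = {l<..<r}"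
  proof
    show "{l<..<r} \<subseteq> ?t ` {..<N}"
    proof
      fix x assume "x \<in> {l<..<r}"
      hence "x = ?t (nat (x - l - 1))" "nat (x - l - 1) < N" by (auto simp: t l_def r_def)
      thus "x \<in> ?t ` {..<N}" by blast
    qed
  qed (auto simp: t l_def r_def)
  have inj: "inj_on ?t {..<N}" by (auto simp: inj_on_def t)
  have "((map_mat complex_of_real (trunc_mat m N M) - \<mu> \<cdot>\<^sub>m 1\<^sub>m N) *\<^sub>v trunc_vec m N u) $ i
      = (\<Sum>j<N. ?f (?t j) - (if j = i then \<mu> * u (?t i) else 0))"
    using i by (auto simp: scalar_prod_def trunc_mat_def trunc_vec_def atLeast0LessThan
        algebra_simps intro!: sum.cong)
  also have "\<dots> = (\<Sum>j\<in>{l<..<r}. ?f j) - \<mu> * u (?t i)"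
    using i by (simp add: sum_subtractf sum.reindex[OF inj, unfolded img o_def])
  also have "\<mu> * u (?t i) = (\<Sum>j\<in>{l..r}. ?f j)"
  proof -
    have "\<mu> * u (?t i) = bi_apply M u (?t i)" by (simp add: eig)
    also have "\<dots> = (\<Sum>j\<in>{?t i - 1, ?t i, ?t i + 1}. ?f j)"
      by (rule bi_apply_tridiagonal[OF tri])
    also have "\<dots> = (\<Sum>j\<in>{l..r}. ?f j)"
      by (rule sum.mono_neutral_left) (use i tri in \<open>auto simp: t l_def r_def\<close>)
    finally show ?thesis .
  qed
  also have "{l..r} = insert l (insert r {l<..<r})" by (auto simp: l_def r_def)
  also have "(\<Sum>j\<in>{l<..<r}. ?f j) - sum ?f (insert l (insert r {l<..<r})) = - ?f l - ?f r"
    by (subst sum.insert; simp add: l_def r_def)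
  also have "?f l = (if i = 0 then of_real (M (l + 1) l) * u l else 0)"
    using tri[of l "?t i"] by (auto simp: t)
  also have "?f r = (if i = N - 1 then of_real (M (r - 1) r) * u r else 0)"
  proof (cases "i = N - 1")
    case True
    hence "?t i = r - 1" using i by (simp add: t l_def r_def)
    thus ?thesis using True by simp
  next
    case False
    hence "r \<notin> {?t i - 1, ?t i, ?t i + 1}" using i by (auto simp: t l_def r_def)
    thus ?thesis using False tri by simp
  qed
  finally show ?thesis .
qed

lemma norm2_truncated_residual:
  fixes M :: "int \<Rightarrow> int \<Rightarrow> real" and u :: "int \<Rightarrow> complex" and m :: int and N :: nat
  assumes tri: "\<And>i j. j \<notin> {i - 1, i, i + 1} \<Longrightarrow> M i j = 0"
    and eig: "bi_apply M u = (\<lambda>i. \<mu> * u i)"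
  defines "l \<equiv> m - int (N div 2)" and "r \<equiv> m - int (N div 2) + int N + 1"
  shows "norm2 ((map_mat complex_of_real (trunc_mat m N M) - \<mu> \<cdot>\<^sub>m 1\<^sub>m N) *\<^sub>v trunc_vec m N u)
    \<le> \<bar>M (l + 1) l\<bar> * cmod (u l) + \<bar>M (r - 1) r\<bar> * cmod (u r)" (is "norm2 ?v \<le> ?L + ?R")
proof -
  have "norm2 ?v \<le> (\<Sum>i<N. cmod (?v $ i))"
    using norm2_le_sum[of ?v] by simp
  also have "\<dots> \<le> (\<Sum>i<N. (if i = 0 then ?L else 0) + (if i = N - 1 then ?R else 0))"
  proof (rule sum_mono)
    fix i assume "i \<in> {..<N}"
    hence i: "i < N" by simp
    have "?v $ i = - (if i = 0 then of_real (M (l + 1) l) * u l else 0) - (if i = N - 1 then of_real (M (r - 1) r) * u r else 0)"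
      unfolding l_def r_def by (rule truncated_row[OF tri eig i])
    also have "cmod \<dots> \<le> cmod (if i = 0 then of_real (M (l + 1) l) * u l else 0)
        + cmod (if i = N - 1 then of_real (M (r - 1) r) * u r else 0)"
      by (metis norm_minus_cancel norm_triangle_ineq4)
    also have "\<dots> = (if i = 0 then ?L else 0) + (if i = N - 1 then ?R else 0)"
      by (simp add: norm_mult)
    finally show "cmod (?v $ i) \<le> (if i = 0 then ?L else 0) + (if i = N - 1 then ?R else 0)" .
  qed
  also have "\<dots> \<le> ?L + ?R"
    by (cases "N = 0") (simp_all add: sum.distrib)
  finally show ?thesis .
qed

lemma pseudoeigenvector_normalised:
  assumes M: "M \<in> carrier_mat (dim_vec v) (dim_vec v)" and v: "norm2 v > 0"
    and res: "norm2 ((M - \<mu> \<cdot>\<^sub>m 1\<^sub>m (dim_vec v)) *\<^sub>v v) < \<epsilon> * norm2 v"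
  shows "pseudoeigenvector \<epsilon> M \<mu> (normalised v)"
proof -
  let ?A = "M - \<mu> \<cdot>\<^sub>m 1\<^sub>m (dim_vec v)"
  have "?A \<in> carrier_mat (dim_vec v) (dim_vec v)" using M by auto
  hence "?A *\<^sub>v normalised v = complex_of_real (1 / norm2 v) \<cdot>\<^sub>v (?A *\<^sub>v v)"
    unfolding normalised_def by (rule mult_mat_vec) auto
  hence "norm2 (?A *\<^sub>v normalised v) = norm2 (?A *\<^sub>v v) / norm2 v"
    using v by (simp add: norm2_smult norm_divide)
  also have "\<dots> < \<epsilon>" using v res by (simp add: divide_less_eq)
  finally have "norm2 (?A *\<^sub>v normalised v) < \<epsilon>" .
  moreover have "norm2 (normalised v) = 1"
    using v by (simp add: normalised_def norm2_smult norm_divide)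
  moreover have "dim_vec (normalised v) = dim_vec v" by (simp add: normalised_def)
  ultimately show ?thesis using M by (simp add: pseudoeigenvector_def)
qed

section \<open>Boundedness of square-summable sequences and rows of the defected operator\<close>

lemma ell2_Z_bounded:
  assumes "u \<in> ell2_Z"
  obtains K where "\<And>i. cmod (u i) \<le> K"
proof -
  have s: "(\<lambda>i. (cmod (u i))\<^sup>2) summable_on UNIV" using assms by (simp add: ell2_Z_def)
  have "(cmod (u i))\<^sup>2 \<le> (\<Sum>\<^sub>\<infinity>i. (cmod (u i))\<^sup>2)" for i
    using finite_sum_le_infsum[OF s, of "{i}"] by simp
  hence "cmod (u i) \<le> sqrt (\<Sum>\<^sub>\<infinity>i. (cmod (u i))\<^sup>2)" for i
    using real_le_rsqrt by blast
  thus thesis by (rule that)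
qed

lemma defect_entry_outside_band:
  "j \<notin> {i - 1, i, i + 1} \<Longrightarrow> defect_entry a b c m d_left d_diag d_right i j = 0"
  by (auto simp: defect_entry_def laurent_entry_def)

lemma bi_apply_defect:
  assumes "i \<noteq> m"
  shows "bi_apply (defect_entry a b c m d_left d_diag d_right) u i
    = of_real (c (i - 1)) * u (i - 1) + of_real (a i) * u i + of_real (b i) * u (i + 1)"
  by (subst bi_apply_tridiagonal)
    (use assms in \<open>auto simp: defect_entry_def laurent_entry_def\<close>)

subsection \<open>Decay of eigenvectors of the defected operator\<close>

text \<open>Away from row \<open>m\<close> the eigenvector solves the pristine recurrence, so each
  half-line is treated by \<open>bounded_solution_decays\<close>. Per period it shrinks by 1/|z'| =
  exp(-(r + beta)) to the right and by |z| = exp(-B) to the left; since r > 0, the left rate is the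
  slower one and bounds both.\<close>

lemma defect_eigenvector_decay:
  assumes k: "k \<ge> 1" and per: "k_periodic k a" "k_periodic k b" "k_periodic k c"
    and bc: "\<And>i. b i * c i > 0" and prod: "(\<Prod>i=1..k. b (int i) / c (int i)) > 1"
    and lam: "lam \<notin> sigma_wind k a b c" "lam \<notin> sigma_det k a b c"
    and u: "ell2_eigenvector (defect_entry a b c m d_left d_diag d_right) (complex_of_real lam) u"
  obtains C where "C \<ge> 0"
    "\<And>n. cmod (u (m + int n)) \<le> C * exp (- (B_rate k a b c lam * real (n div k)))"
    "\<And>n. cmod (u (m - int n)) \<le> C * exp (- (B_rate k a b c lam * real (n div k)))"
proof -
  let ?B = "B_rate k a b c lam"
  obtain z z' where zz: "symbol_det k a b c lam z = 0" "symbol_det k a b c lam z' = 0"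
    and z: "cmod z = exp (- ?B)" and z': "cmod z' = exp (r_rate k b c + beta_tilde k a b c lam)"
    using symbol_det_roots(3)[OF k bc prod lam] by blast
  have z0: "z \<noteq> 0" "z' \<noteq> 0" using z z' by auto
  have B: "?B > 0" by (rule symbol_det_roots(2)[OF k bc prod lam])
  have r: "r_rate k b c > 0" by (rule A_coeff_ratio(3)[OF bc prod])
  have cz: "cmod z < 1" using z B by simp
  have cz': "cmod z' > 1" and iz': "cmod (inverse z') \<le> exp (- ?B)"
    using z' B r by (simp_all add: B_rate_def norm_inverse flip: exp_minus)
  obtain \<phi> where \<phi>:
    "\<And>i. of_real (c (i - 1)) * \<phi> (i - 1) + of_real (a i - lam) * \<phi> i + of_real (b i) * \<phi> (i + 1) = 0"
    "\<And>i q. \<phi> (i + int k * q) = \<phi> i * z powi (- q)" "\<exists>i. \<phi> i \<noteq> 0"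
    using floquet_solution[OF k per z0(1) zz(1)] by blast
  obtain \<psi> where \<psi>:
    "\<And>i. of_real (c (i - 1)) * \<psi> (i - 1) + of_real (a i - lam) * \<psi> i + of_real (b i) * \<psi> (i + 1) = 0"
    "\<And>i q. \<psi> (i + int k * q) = \<psi> i * z' powi (- q)" "\<exists>i. \<psi> i \<noteq> 0"
    using floquet_solution[OF k per z0(2) zz(2)] by blast
  obtain K where K: "\<And>i. cmod (u i) \<le> K"
    using u ell2_Z_bounded unfolding ell2_eigenvector_def by blast
  have rec: "of_real (c (i - 1)) * u (i - 1) + of_real (a i - lam) * u i + of_real (b i) * u (i + 1) = 0"
    if "i \<noteq> m" for i
  proof -
    have "of_real lam * u i = bi_apply (defect_entry a b c m d_left d_diag d_right) u i"
      using u by (simp add: ell2_eigenvector_def)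
    also have "\<dots> = of_real (c (i - 1)) * u (i - 1) + of_real (a i) * u i + of_real (b i) * u (i + 1)"
      by (rule bi_apply_defect[OF that])
    finally show ?thesis by (simp add: algebra_simps)
  qed
  have bc0: "b i \<noteq> 0" "c i \<noteq> 0" for i using bc[of i] by auto
  \<comment> \<open>The recurrence is centred at \<open>m + n + 1\<close>, so row \<open>m\<close>
    never enters and \<open>u m\<close> is only an initial value.\<close>
  have sol_right: "of_real (c (m + int n)) * h (m + int n) + of_real (a (m + int n + 1) - lam) * h (m + int (n + 1))
      + of_real (b (m + int n + 1)) * h (m + int (n + 2)) = 0"
    if "\<And>i. i \<noteq> m \<Longrightarrow> of_real (c (i - 1)) * h (i - 1) + of_real (a i - lam) * h i + of_real (b i) * h (i + 1) = 0"
    for h :: "int \<Rightarrow> complex" and n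
    using that[of "m + int n + 1"] by (simp add: algebra_simps)
  \<comment> \<open>Read leftwards, the roles of \<open>b\<close> and \<open>c\<close> are
    exchanged, and \<open>c\<close> becomes the leading coefficient.\<close>
  have sol_left: "of_real (b (m - int n - 1)) * h (m - int n) + of_real (a (m - int n - 1) - lam) * h (m - int (n + 1))
      + of_real (c (m - int n - 2)) * h (m - int (n + 2)) = 0"
    if "\<And>i. i \<noteq> m \<Longrightarrow> of_real (c (i - 1)) * h (i - 1) + of_real (a i - lam) * h i + of_real (b i) * h (i + 1) = 0"
    for h :: "int \<Rightarrow> complex" and n
    using that[of "m - int n - 1"] by (simp add: algebra_simps)
  have q_right: "h (m + int (n + k)) = inverse y * h (m + int n)"
    and q_left: "h (m - int (n + k)) = y * h (m - int n)"
    if "\<And>i q. h (i + int k * q) = h i * y powi (- q)" for h :: "int \<Rightarrow> complex" and y n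
    using that[of "m + int n" 1] that[of "m - int n" "- 1"]
    by (simp_all add: power_int_minus algebra_simps)
  have right: "u (m + int (n + k)) = inverse z' * u (m + int n)" for n
  proof (rule bounded_solution_decays[where \<phi> = "\<lambda>n. \<phi> (m + int n)" and \<psi> = "\<lambda>n. \<psi> (m + int n)"
        and u = "\<lambda>n. u (m + int n)" and w = "inverse z" and K = K])
    show "1 < cmod (inverse z)" using cz z0 by (simp add: norm_inverse one_less_inverse_iff)
    show "cmod (inverse z') \<le> 1" using iz' B by (smt (verit) exp_le_one_iff)
    show "complex_of_real (b (m + int n + 1)) \<noteq> 0" for n by (simp add: bc0)
  qed (rule sol_right sol_left q_right q_left quasi_periodic_nonzero \<phi> \<psi> k z0 rec K | assumption)+
  \<comment> \<open>Reflection inverts the multipliers, so \<open>\<phi>\<close> and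
    \<open>\<psi>\<close> swap roles: now \<open>\<psi>\<close> grows and \<open>\<phi>\<close>
    decays.\<close>
  have left: "u (m - int (n + k)) = z * u (m - int n)" for n
  proof (rule bounded_solution_decays[where \<phi> = "\<lambda>n. \<psi> (m - int n)" and \<psi> = "\<lambda>n. \<phi> (m - int n)"
        and u = "\<lambda>n. u (m - int n)" and w = z' and K = K])
    show "1 < cmod z'" by (rule cz')
    show "cmod z \<le> 1" using cz by simp
    show "complex_of_real (c (m - int n - 2)) \<noteq> 0" for n by (simp add: bc0)
  qed (rule sol_left q_left quasi_periodic_nonzero \<phi> \<psi> k z0 rec K | assumption)+
  define C1 C2 where "C1 = (\<Sum>j<k. cmod (u (m + int j)))" and "C2 = (\<Sum>j<k. cmod (u (m - int j)))"
  have C: "C1 \<ge> 0" "C2 \<ge> 0" by (simp_all add: C1_def C2_def sum_nonneg)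
  have pw: "exp (- ?B) ^ q = exp (- (?B * real q))" for q
    by (simp add: exp_of_nat_mult[symmetric] mult.commute)
  show thesis
  proof (rule that[of "C1 + C2"])
    fix n
    let ?E = "exp (- (?B * real (n div k)))"
    have "cmod (u (m + int n)) \<le> C1 * cmod (inverse z') ^ (n div k)"
      unfolding C1_def by (rule quasi_periodic_norm_bound[where u = "\<lambda>n. u (m + int n)", OF k right])
    also have "\<dots> \<le> (C1 + C2) * exp (- ?B) ^ (n div k)"
      using C iz' by (intro mult_mono power_mono) auto
    finally show "cmod (u (m + int n)) \<le> (C1 + C2) * ?E" by (simp add: pw)
    have "cmod (u (m - int n)) \<le> C2 * cmod z ^ (n div k)"
      unfolding C2_def by (rule quasi_periodic_norm_bound[where u = "\<lambda>n. u (m - int n)", OF k left])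
    also have "\<dots> \<le> (C1 + C2) * exp (- ?B) ^ (n div k)"
      using C by (intro mult_mono power_mono) (auto simp: z)
    finally show "cmod (u (m - int n)) \<le> (C1 + C2) * ?E" by (simp add: pw)
  qed (use C in simp)
qed

theorem theorem2p14:
  fixes k :: nat and a b c :: "int \<Rightarrow> real" and m :: int
    and d_left d_diag d_right lam :: real and u :: "int \<Rightarrow> complex"
  assumes "k \<ge> 1"
    and "k_periodic k a" and "k_periodic k b" and "k_periodic k c"
    and "\<And>i. b i * c i > 0"
    and "(\<Prod>i=1..k. b (int i) / c (int i)) > 1"
    and "lam \<in> (UNIV - sigma_wind k a b c) - sigma_det k a b c"
    and "ell2_eigenvector (defect_entry a b c m d_left d_diag d_right) (complex_of_real lam) u"
  shows "beta_tilde k a b c lam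
           = arcosh \<bar>g_fun k a b c lam / (2 * A_coeff k c * exp (r_rate k b c))\<bar>
       \<and> B_rate k a b c lam > 0
       \<and> (\<exists>\<epsilon> :: nat \<Rightarrow> real.
            \<epsilon> \<in> O(\<lambda>N. exp (- (B_rate k a b c lam * real (N div (2 * k))))) \<and>
            (\<forall>\<^sub>F N in sequentially.
               trunc_vec m N u \<noteq> 0\<^sub>v N \<and>
               pseudoeigenvector (\<epsilon> N)
                 (map_mat complex_of_real
                   (trunc_mat m N (defect_entry a b c m d_left d_diag d_right)))
                 (complex_of_real lam)
                 (normalised (trunc_vec m N u))))"
proof -
  let ?B = "B_rate k a b c lam" and ?M = "defect_entry a b c m d_left d_diag d_right"
  have lam: "lam \<notin> sigma_wind k a b c" "lam \<notin> sigma_det k a b c" using assms(7) by auto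
  note roots = symbol_det_roots[OF assms(1,5,6) lam]
  obtain C where C: "C \<ge> 0"
    "\<And>n. cmod (u (m + int n)) \<le> C * exp (- (?B * real (n div k)))"
    "\<And>n. cmod (u (m - int n)) \<le> C * exp (- (?B * real (n div k)))"
    using defect_eigenvector_decay[OF assms(1-6) lam assms(8)] by blast
  define K where "K = (\<Sum>j<k. \<bar>b (int j)\<bar>) + (\<Sum>j<k. \<bar>c (int j)\<bar>)"
  have K: "\<bar>b i\<bar> \<le> K" "\<bar>c i\<bar> \<le> K" for i
    using k_periodic_bounded[OF assms(3,1), of i] k_periodic_bounded[OF assms(4,1), of i]
      sum_nonneg[of "{..<k}" "\<lambda>j. \<bar>b (int j)\<bar>"] sum_nonneg[of "{..<k}" "\<lambda>j. \<bar>c (int j)\<bar>"]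
    unfolding K_def by auto
  have K0: "K \<ge> 0" using K(1)[of 0] by linarith
  have eig: "bi_apply ?M u = (\<lambda>i. of_real lam * u i)" and "u \<noteq> (\<lambda>_. 0)"
    using assms(8) by (simp_all add: ell2_eigenvector_def)
  then obtain i0 where i0: "u i0 \<noteq> 0" by auto
  let ?E = "\<lambda>N. exp (- (?B * real (N div (2 * k))))"
  \<comment> \<open>Each end of the window contributes at most \<open>K * C\<close> times the
    exponential to the residual, and |u i0| bounds the norm of the truncation from below; the added
    1 makes the inequality strict.\<close>
  define D where "D = 2 * K * C / cmod (u i0) + 1"
  have "trunc_vec m N u \<noteq> 0\<^sub>v N \<and> pseudoeigenvector (D * ?E N)
      (map_mat complex_of_real (trunc_mat m N ?M)) (complex_of_real lam) (normalised (trunc_vec m N u))"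
    \<comment> \<open>From this size on the window contains \<open>i0\<close>, and its first and
      last rows differ from row \<open>m\<close>.\<close>
    if N: "N \<ge> nat (2 * \<bar>i0 - m\<bar> + 4)" for N
  proof -
    let ?v = "trunc_vec m N u"
    define l r where "l = m - int (N div 2)" and "r = m - int (N div 2) + int N + 1"
    define j where "j = nat (i0 - m + int (N div 2) - 1)"
    have N': "2 * \<bar>i0 - m\<bar> + 4 \<le> int N" using N by linarith
    define h where "h = int (N div 2)"
    have h2: "2 * h \<le> int N" "int N < 2 * h + 2" by (simp_all add: h_def)
    have h: "\<bar>i0 - m\<bar> + 2 \<le> int (N div 2)"
      unfolding h_def[symmetric] using N' h2 by presburger
    have "0 \<le> i0 - m + int (N div 2) - 1" "i0 - m + int (N div 2) - 1 < int N"
      unfolding h_def[symmetric] using N' h2 by presburger+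
    hence j: "j < N" "trunc_index m N j = i0" by (auto simp: j_def trunc_index_def nat_less_iff)
    have dim: "dim_vec ?v = N" by (simp add: trunc_vec_def)
    have vj: "?v $ j = u i0" using j by (simp add: trunc_vec_def)
    hence v0: "?v \<noteq> 0\<^sub>v N" using i0 j by auto
    have norm: "cmod (u i0) \<le> norm2 ?v" using norm_index_le_norm2[of j ?v] j dim vj by simp
    \<comment> \<open>The two dropped entries lie in pristine rows, so the periodic bound
      \<open>K\<close> applies to them.\<close>
    have "?M (l + 1) l = c l" "?M (r - 1) r = b (r - 1)"
      using h by (auto simp: defect_entry_def laurent_entry_def l_def r_def)
    hence Mb: "\<bar>?M (l + 1) l\<bar> \<le> K" "\<bar>?M (r - 1) r\<bar> \<le> K" using K by simp_all
    have half: "N div 2 div k = N div (2 * k)" by (simp add: div_mult2_eq)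
    have ul: "cmod (u l) \<le> C * ?E N" using C(3)[of "N div 2"] by (simp add: l_def half)
    \<comment> \<open>The site \<open>r\<close> is farther from \<open>m\<close> than
      \<open>N div 2\<close>, the distance of \<open>l\<close>; as B > 0, the same exponential
      bounds both.\<close>
    have r: "r = m + int (N - N div 2 + 1)" by (simp add: r_def of_nat_diff)
    have "N div (2 * k) \<le> (N - N div 2 + 1) div k"
      unfolding half[symmetric] by (rule div_le_mono) simp
    hence "?B * real (N div (2 * k)) \<le> ?B * real ((N - N div 2 + 1) div k)"
      using roots(2) by (intro mult_left_mono) auto
    hence ur: "cmod (u r) \<le> C * ?E N"
      unfolding r by (intro order_trans[OF C(2)] mult_left_mono) (use C(1) in auto)
    have "norm2 ((map_mat complex_of_real (trunc_mat m N ?M) - complex_of_real lam \<cdot>\<^sub>m 1\<^sub>m N) *\<^sub>v ?v)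
        \<le> \<bar>?M (l + 1) l\<bar> * cmod (u l) + \<bar>?M (r - 1) r\<bar> * cmod (u r)"
      unfolding l_def r_def by (rule norm2_truncated_residual[OF defect_entry_outside_band eig])
    also have "\<dots> \<le> K * (C * ?E N) + K * (C * ?E N)"
      by (intro add_mono mult_mono Mb ul ur) (auto simp: K0)
    also have "\<dots> < D * ?E N * cmod (u i0)"
      using i0 by (simp add: D_def field_simps)
    also have "\<dots> \<le> D * ?E N * norm2 ?v"
      using norm K0 C(1) by (intro mult_left_mono) (auto simp: D_def)
    finally have res: "norm2 ((map_mat complex_of_real (trunc_mat m N ?M)
        - complex_of_real lam \<cdot>\<^sub>m 1\<^sub>m (dim_vec ?v)) *\<^sub>v ?v) < D * ?E N * norm2 ?v"
      unfolding dim .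
    have "norm2 ?v > 0" using norm i0 by (smt (verit) zero_less_norm_iff)
    thus ?thesis using v0 res
      by (intro conjI pseudoeigenvector_normalised) (auto simp: dim trunc_mat_def)
  qed
  hence "\<forall>\<^sub>F N in sequentially. trunc_vec m N u \<noteq> 0\<^sub>v N \<and> pseudoeigenvector (D * ?E N)
      (map_mat complex_of_real (trunc_mat m N ?M)) (complex_of_real lam) (normalised (trunc_vec m N u))"
    unfolding eventually_sequentially by blast
  moreover have "(\<lambda>N. D * ?E N) \<in> O(?E)"
    by (rule bigoI[of _ "\<bar>D\<bar>"]) (simp add: abs_mult)
  ultimately show ?thesis using roots(1,2) by blast
qed

end
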